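(* Let $(X,T)$ be a weakly mixing dynamical system with the shadowing property. For every $\varepsilon>0$ there exists $M>0$ such that for any $k\ge2$, any $k$ points $x_1,x_2,\dots,x_k\in X$, any non-negative integers $0\le a_1\le b_1<a_2\le b_2<\dots<a_k\le b_k$ with $a_i-b_{i-1}\ge M$ for each $i=2,3,\dots,k$, and any integer $p\ge M+b_k-a_1$, there exists a point $z\in X$ whose orbit closure $\overline{\{T^nz\colon n\ge0\}}$ (with the restriction of $T$) is an odometer and such that additionally $d(T^{j}(z),T^{np+j}(z))<\varepsilon$ for every $n,j\ge0$, and $d(T^{np+j}(z),T^j(x_i))<\varepsilon$ for all $a_i\le j\le b_i$, $1\le i\le k$ and $n\ge0$.
   Context: A dynamical system $(X,T)$ is a compact metric space $(X,d)$ with a continuous map $T\colon X\to X$ (not necessarily invertible). It is transitive if for any two nonempty open sets $U,V\subset X$ there is $n>0$ with $T^n(U)\cap V\neq\emptyset$, and weakly mixing if $(X\times X,T\times T)$ is transitive. A sequence $(x_n)_{n=0}^\infty$ in $X$ is a $\delta$-pseudo-orbit if $d(T(x_n),x_{n+1})<\delta$ for all $n\ge 0$; it is $\varepsilon$-traced by $y\in X$ if $d(T^n(y),x_n)<\varepsilon$ for all $n\ge 0$. $(X,T)$ has the shadowing property if for every $\varepsilon>0$ there is $\delta>0$ such that every $\delta$-pseudo-orbit is $\varepsilon$-traced by some point of $X$. A point $x$ is regularly recurrent if for every open neighborhood $U$ of $x$ there is $k\ge 1$ with $T^{kn}(x)\in U$ for all $n\ge 0$. A system is equicontinuous if for every $\varepsilon>0$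 there is $\delta>0$ such that $d(x,y)<\delta$ implies $d(T^n(x),T^n(y))<\varepsilon$ for all $n\ge 0$. An odometer is an equicontinuous system containing a regularly recurrent point with dense (forward) orbit (periodic orbits are odometers). *)

theory Defs
  imports "HOL-Analysis.Analysis"
begin

text \<open>
  A system is a carrier set \<open>X\<close> in a metric space together with a map \<open>T\<close>, of which only the
  restriction to \<open>X\<close> matters. Hence a subsystem is obtained by shrinking the carrier, keeping the
  same \<open>T\<close>. Open sets of the system are the relatively open subsets of \<open>X\<close>.
\<close>

definition dynamical_system :: "'a::metric_space set \<Rightarrow> ('a \<Rightarrow> 'a) \<Rightarrow> bool" where
  "dynamical_system X T \<longleftrightarrow> compact X \<and> continuous_on X T \<and> T ` X \<subseteq> X"

definition transitive_system :: "'a::metric_space set \<Rightarrow> ('a \<Rightarrow> 'a) \<Rightarrow> bool" where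
  "transitive_system X T \<longleftrightarrow>
    (\<forall>U V. openin (top_of_set X) U \<and> U \<noteq> {} \<and> openin (top_of_set X) V \<and> V \<noteq> {} \<longrightarrow>
      (\<exists>n>0. (T ^^ n) ` U \<inter> V \<noteq> {}))"

definition weakly_mixing :: "'a::metric_space set \<Rightarrow> ('a \<Rightarrow> 'a) \<Rightarrow> bool" where
  "weakly_mixing X T \<longleftrightarrow> transitive_system (X \<times> X) (map_prod T T)"

definition pseudo_orbit :: "'a::metric_space set \<Rightarrow> ('a \<Rightarrow> 'a) \<Rightarrow> real \<Rightarrow> (nat \<Rightarrow> 'a) \<Rightarrow> bool" where
  "pseudo_orbit X T \<delta> x \<longleftrightarrow> (\<forall>n. x n \<in> X) \<and> (\<forall>n. dist (T (x n)) (x (Suc n)) < \<delta>)"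

definition traced_by :: "('a::metric_space \<Rightarrow> 'a) \<Rightarrow> real \<Rightarrow> (nat \<Rightarrow> 'a) \<Rightarrow> 'a \<Rightarrow> bool" where
  "traced_by T \<epsilon> x y \<longleftrightarrow> (\<forall>n. dist ((T ^^ n) y) (x n) < \<epsilon>)"

definition shadowing_property :: "'a::metric_space set \<Rightarrow> ('a \<Rightarrow> 'a) \<Rightarrow> bool" where
  "shadowing_property X T \<longleftrightarrow>
    (\<forall>\<epsilon>>0. \<exists>\<delta>>0. \<forall>x. pseudo_orbit X T \<delta> x \<longrightarrow> (\<exists>y\<in>X. traced_by T \<epsilon> x y))"

definition regularly_recurrent :: "'a::metric_space set \<Rightarrow> ('a \<Rightarrow> 'a) \<Rightarrow> 'a \<Rightarrow> bool" where
  "regularly_recurrent X T x \<longleftrightarrow>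
    (\<forall>U. openin (top_of_set X) U \<and> x \<in> U \<longrightarrow> (\<exists>k\<ge>1. \<forall>n. (T ^^ (k * n)) x \<in> U))"

definition equicontinuous_system :: "'a::metric_space set \<Rightarrow> ('a \<Rightarrow> 'a) \<Rightarrow> bool" where
  "equicontinuous_system X T \<longleftrightarrow>
    (\<forall>\<epsilon>>0. \<exists>\<delta>>0. \<forall>x\<in>X. \<forall>y\<in>X. dist x y < \<delta> \<longrightarrow> (\<forall>n. dist ((T ^^ n) x) ((T ^^ n) y) < \<epsilon>))"

text \<open>
  The closure is taken in the ambient type; for a point of a system \<open>(X, T)\<close> it coincides with
  the closure in \<open>X\<close>, since \<open>X\<close> is compact and invariant.
\<close>

definition orbit_closure :: "('a::metric_space \<Rightarrow> 'a) \<Rightarrow> 'a \<Rightarrow> 'a set" where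
  "orbit_closure T x = closure (range (\<lambda>n. (T ^^ n) x))"

definition odometer :: "'a::metric_space set \<Rightarrow> ('a \<Rightarrow> 'a) \<Rightarrow> bool" where
  "odometer X T \<longleftrightarrow> dynamical_system X T \<and> equicontinuous_system X T \<and>
    (\<exists>x\<in>X. regularly_recurrent X T x \<and> orbit_closure T x = X)"

end

theory Submission
  imports Defs
begin

text \<open>
  Weak mixing yields, for each \<open>\<delta>\<close>, some \<open>M\<close> such that any two points are joined by
  \<open>\<delta>\<close>-chains of every length \<open>\<ge> M\<close>: a point has \<open>\<delta>\<close>-loops of two consecutive lengths. Hence the
  prescribed orbit segments lie on a \<open>p\<close>-periodic \<open>\<delta>\<close>-pseudo-orbit. If \<open>y\<close> shadows a
  \<open>p\<close>-periodic pseudo-orbit, then by compactness two of the points \<open>(T ^^ (n * p)) y\<close> are close, and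
  repeating the segment of the orbit of \<open>y\<close> between them gives a periodic pseudo-orbit, whose period
  is a multiple of \<open>p\<close>, with a smaller error, uniformly close to the first one. Iterating, the
  pseudo-orbits converge uniformly to a true orbit. A uniform limit of periodic sequences, it has an odometer as its closure.
\<close>

text \<open>Encoded as a relation so that \<delta>-chains with \<open>n\<close> steps become the
  relational power \<open>chain_step X T \<delta> ^^ n\<close>, and concatenating chains is
  \<open>relpow_add\<close>.\<close>

definition chain_step :: "'a::metric_space set \<Rightarrow> ('a \<Rightarrow> 'a) \<Rightarrow> real \<Rightarrow> ('a \<times> 'a) set" where
  "chain_step X T \<delta> = {(x, y). x \<in> X \<and> y \<in> X \<and> dist (T x) y < \<delta>}"

text \<open>Up to a factor 2 in \<eta>, this says that the orbit sequence of \<open>z\<close> is a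
  uniform limit of periodic sequences. The period \<open>q\<close> depends on \<eta> but not on the
  time \<open>j\<close>.\<close>

definition limit_periodic :: "('a::metric_space \<Rightarrow> 'a) \<Rightarrow> 'a \<Rightarrow> bool" where
  "limit_periodic T z \<longleftrightarrow>
    (\<forall>\<eta>>0. \<exists>q\<ge>1. \<forall>n j. dist ((T ^^ j) z) ((T ^^ (n * q + j)) z) < \<eta>)"

section \<open>Iterates, and odometers from limit-periodic points\<close>

lemma funpow_in:
  assumes "T ` X \<subseteq> X" "x \<in> X"
  shows "(T ^^ n) x \<in> X"
  using assms by (induction n) auto

lemma continuous_on_funpow:
  assumes "continuous_on X T" "T ` X \<subseteq> X"
  shows "continuous_on X (T ^^ n)"
proof (induction n)
  case 0
  show ?case by (simp add: id_def)
next
  case (Suc n)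
  have "(T ^^ n) ` X \<subseteq> X"
    by (auto intro: funpow_in[OF assms(2)])
  then have "continuous_on ((T ^^ n) ` X) T"
    by (rule continuous_on_subset[OF assms(1)])
  then show ?case
    using continuous_on_compose[OF Suc] by simp
qed

text \<open>Near-periodicity of the orbit of \<open>z\<close> passes to its closure by continuity.
  There \<open>T ^^ n\<close> is uniformly close to \<open>T ^^ (n mod q)\<close>, so equicontinuity
  reduces to finitely many uniformly continuous iterates. Regular recurrence is the case
  \<open>j = 0\<close> of near-periodicity.\<close>

lemma limit_periodic_imp_odometer:
  assumes X: "dynamical_system X T" and z: "z \<in> X" and lp: "limit_periodic T z"
  shows "odometer (orbit_closure T z) T"
proof -
  define Y where "Y = orbit_closure T z"
  have cX: "compact X" and contX: "continuous_on X T" and TX: "T ` X \<subseteq> X"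
    using X by (auto simp: dynamical_system_def)
  have orbX: "range (\<lambda>n. (T ^^ n) z) \<subseteq> X"
    using funpow_in[OF TX z] by auto
  have orbY: "(T ^^ n) z \<in> Y" for n
    unfolding Y_def orbit_closure_def using closure_subset by fastforce
  have YX: "Y \<subseteq> X"
    unfolding Y_def orbit_closure_def
    using closure_minimal[OF orbX] compact_imp_closed[OF cX] by simp
  have cY: "compact Y"
    using YX cX unfolding Y_def orbit_closure_def
    by (metis closed_closure compact_Int_closed inf.absorb_iff2)
  have clY: "closed Y" using cY by (rule compact_imp_closed)
  have contY: "continuous_on Y T"
    using contX YX continuous_on_subset by blast
  have TY: "T ` Y \<subseteq> Y"
  proof -
    have "T ` closure (range (\<lambda>n. (T ^^ n) z)) \<subseteq> Y"
    proof (rule image_closure_subset)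
      show "continuous_on (closure (range (\<lambda>n. (T ^^ n) z))) T"
        using contY by (simp add: Y_def orbit_closure_def)
      show "T ` range (\<lambda>n. (T ^^ n) z) \<subseteq> Y"
        using orbY[of "Suc _"] by auto
    qed (rule clY)
    then show ?thesis by (simp add: Y_def orbit_closure_def)
  qed
  have ds: "dynamical_system Y T"
    using cY contY TY by (simp add: dynamical_system_def)
  have contYn: "continuous_on Y (T ^^ n)" for n
    using continuous_on_funpow[OF contY TY] .
  have eq: "equicontinuous_system Y T"
    unfolding equicontinuous_system_def
  proof (intro allI impI)
    fix e :: real assume "e > 0"
    then have "e / 4 > 0" by simp
    then obtain q where q: "q \<ge> 1"
      and qz: "\<And>n j. dist ((T ^^ j) z) ((T ^^ (n * q + j)) z) < e / 4"
      using lp unfolding limit_periodic_def by meson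
    \<comment> \<open>For \<open>u = (T ^^ m) z\<close> this is \<open>qz\<close> at time
      \<open>j + m\<close>. For a limit of such points the strict inequality becomes \<le>, since
      the distance is continuous in \<open>u\<close>.\<close>
    have qY: "dist ((T ^^ j) u) ((T ^^ (n * q + j)) u) \<le> e / 4" if "u \<in> Y" for u n j
    proof -
      let ?f = "\<lambda>u. dist ((T ^^ j) u) ((T ^^ (n * q + j)) u)"
      have "?f ` closure (range (\<lambda>n. (T ^^ n) z)) \<subseteq> {..e / 4}"
      proof (rule image_closure_subset)
        show "continuous_on (closure (range (\<lambda>n. (T ^^ n) z))) ?f"
          using contYn by (intro continuous_on_dist) (simp_all add: Y_def orbit_closure_def)
        show "?f ` range (\<lambda>n. (T ^^ n) z) \<subseteq> {..e / 4}"
        proof clarsimp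
          fix m
          show "dist ((T ^^ j) ((T ^^ m) z)) ((T ^^ (n * q + j)) ((T ^^ m) z)) * 4 \<le> e"
            using qz[of "j + m" n] by (simp add: funpow_add[symmetric, THEN fun_cong, unfolded o_def] add.assoc)
        qed
      qed simp
      then show ?thesis using that by (auto simp: Y_def orbit_closure_def)
    qed
    \<comment> \<open>A common modulus of continuity for the first \<open>N\<close> iterates, used
      below with \<open>N = q\<close>.\<close>
    have "\<exists>d>0. \<forall>u\<in>Y. \<forall>v\<in>Y. dist u v < d \<longrightarrow> (\<forall>r<N. dist ((T ^^ r) u) ((T ^^ r) v) < e / 4)" for N
    proof (induction N)
      case 0
      show ?case by (auto intro: exI[of _ 1])
    next
      case (Suc N)
      then obtain d where d: "d > 0"
        "\<forall>u\<in>Y. \<forall>v\<in>Y. dist u v < d \<longrightarrow> (\<forall>r<N. dist ((T ^^ r) u) ((T ^^ r) v) < e / 4)" by blast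
      have "uniformly_continuous_on Y (T ^^ N)"
        using compact_uniformly_continuous[OF contYn cY] .
      then obtain d' where d': "d' > 0"
        "\<forall>u\<in>Y. \<forall>v\<in>Y. dist u v < d' \<longrightarrow> dist ((T ^^ N) u) ((T ^^ N) v) < e / 4"
        unfolding uniformly_continuous_on_def using \<open>e / 4 > 0\<close> by (metis dist_commute)
      show ?case
        using d d' by (intro exI[of _ "min d d'"]) (auto simp: less_Suc_eq)
    qed
    then obtain d where d: "d > 0"
      "\<And>u v r. u \<in> Y \<Longrightarrow> v \<in> Y \<Longrightarrow> dist u v < d \<Longrightarrow> r < q \<Longrightarrow>
        dist ((T ^^ r) u) ((T ^^ r) v) < e / 4" by meson
    \<comment> \<open>Reducing time \<open>n\<close> modulo \<open>q\<close> costs at most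
      \<open>e / 4\<close> at \<open>u\<close> and at \<open>v\<close>, and the remaining iterate
      costs less than \<open>e / 4\<close>.\<close>
    have "dist ((T ^^ n) u) ((T ^^ n) v) < e" if uv: "u \<in> Y" "v \<in> Y" "dist u v < d" for u v n
    proof -
      let ?r = "n mod q" and ?m = "n div q"
      have n: "?m * q + ?r = n" by simp
      have "dist ((T ^^ ?r) u) ((T ^^ ?r) v) < e / 4"
        using d(2)[OF uv] q by simp
      moreover have "dist ((T ^^ ?r) u) ((T ^^ n) u) \<le> e / 4"
        using qY[OF uv(1), of ?r ?m] unfolding n .
      moreover have "dist ((T ^^ ?r) v) ((T ^^ n) v) \<le> e / 4"
        using qY[OF uv(2), of ?r ?m] unfolding n .
      ultimately show ?thesis
        using dist_triangle[of "(T ^^ n) u" "(T ^^ n) v" "(T ^^ ?r) u"]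
          dist_triangle[of "(T ^^ ?r) u" "(T ^^ n) v" "(T ^^ ?r) v"] \<open>e > 0\<close>
        by (simp add: dist_commute)
    qed
    then show "\<exists>d>0. \<forall>u\<in>Y. \<forall>v\<in>Y. dist u v < d \<longrightarrow> (\<forall>n. dist ((T ^^ n) u) ((T ^^ n) v) < e)"
      using d(1) by blast
  qed
  have rr: "regularly_recurrent Y T z"
    unfolding regularly_recurrent_def
  proof (intro allI impI, elim conjE)
    fix U assume "openin (top_of_set Y) U" "z \<in> U"
    then obtain \<eta> where \<eta>: "\<eta> > 0" "ball z \<eta> \<inter> Y \<subseteq> U"
      unfolding openin_contains_ball by blast
    then obtain q where "q \<ge> 1" "\<And>n j. dist ((T ^^ j) z) ((T ^^ (n * q + j)) z) < \<eta>"
      using lp unfolding limit_periodic_def by meson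
    then have "\<forall>n. (T ^^ (q * n)) z \<in> U"
      using \<eta>(2) orbY by (metis IntI add.right_neutral funpow_0 mem_ball mult.commute subsetD)
    then show "\<exists>k\<ge>1. \<forall>n. (T ^^ (k * n)) z \<in> U"
      using \<open>q \<ge> 1\<close> by blast
  qed
  show ?thesis
    using ds eq rr orbY[of 0] unfolding odometer_def Y_def by auto
qed

section \<open>Shadowing periodic pseudo-orbits by limit-periodic points\<close>

text \<open>The step that wraps around is legitimate because \<open>f p = f 0\<close>. The offset
  \<open>c\<close> chooses the phase at which the loop is entered.\<close>

lemma pseudo_orbit_mod:
  assumes "p \<ge> 1" "\<And>i. i < p \<Longrightarrow> (f i, f (Suc i)) \<in> chain_step X T \<delta>" "f p = f 0"
  shows "pseudo_orbit X T \<delta> (\<lambda>j. f ((j + c) mod p))"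
proof -
  have "(f ((j + c) mod p), f (Suc (j + c) mod p)) \<in> chain_step X T \<delta>" for j
  proof (cases "Suc ((j + c) mod p) = p")
    case True
    then show ?thesis
      using assms(1) assms(2)[of "(j + c) mod p"] assms(3) by (simp add: mod_Suc)
  next
    case False
    then show ?thesis
      using assms(1) assms(2)[of "(j + c) mod p"] by (simp add: mod_Suc)
  qed
  then show ?thesis
    by (auto simp: pseudo_orbit_def chain_step_def)
qed

text \<open>The points \<open>(T ^^ (n * p)) y\<close> lie in a compact set, so two of them are
  closer than \<delta>, however small \<delta> is compared with \<open>e\<close>. The orbit piece
  between them, repeated, has errors only where it closes up. Its length is a multiple of
  \<open>p\<close>, so it keeps in phase with \<xi> and inherits the bound \<open>e\<close> from the
  tracing.\<close>

lemma refine_periodic_pseudo_orbit: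
  assumes X: "dynamical_system X T" and y: "y \<in> X" "traced_by T e \<xi> y"
    and p: "p \<ge> 1" "\<And>j. \<xi> (j mod p) = \<xi> j" and "\<delta> > 0"
  obtains \<xi>' p' where "p' \<ge> 1" "p dvd p'" "\<And>j. \<xi>' (j mod p') = \<xi>' j"
    "pseudo_orbit X T \<delta> \<xi>'" "\<And>j. dist (\<xi>' j) (\<xi> j) < e"
proof -
  have cX: "compact X" and TX: "T ` X \<subseteq> X"
    using X by (auto simp: dynamical_system_def)
  have "\<forall>n. (T ^^ (n * p)) y \<in> X" using funpow_in[OF TX y(1)] by blast
  then obtain l r where r: "strict_mono r" "((\<lambda>n. (T ^^ (n * p)) y) \<circ> r) \<longlonglongrightarrow> l"
    using cX unfolding compact_def by metis
  have "Cauchy ((\<lambda>n. (T ^^ (n * p)) y) \<circ> r)"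
    using r(2) LIMSEQ_imp_Cauchy by blast
  then obtain N where N: "\<And>m n. m \<ge> N \<Longrightarrow> n \<ge> N \<Longrightarrow>
      dist ((T ^^ (r m * p)) y) ((T ^^ (r n * p)) y) < \<delta>"
    using \<open>\<delta> > 0\<close> unfolding Cauchy_def by fastforce
  define n m where "n = r N" and "m = r (Suc N) - r N"
  have "r N < r (Suc N)" using r(1) by (simp add: strict_mono_def)
  then have m: "m \<ge> 1" and nm: "r (Suc N) = m + n" by (auto simp: m_def n_def)
  define y' where "y' = (T ^^ (n * p)) y"
  define p' where "p' = m * p"
  \<comment> \<open>The last point is replaced by \<open>y'\<close> so that the chain closes
    exactly; \<open>ret\<close> bounds the only error.\<close>
  define f where "f i = (if i = p' then y' else (T ^^ i) y')" for i
  have Ty': "(T ^^ j) y' = (T ^^ (j + n * p)) y" for j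
    by (simp add: y'_def funpow_add)
  have ret: "dist ((T ^^ p') y') y' < \<delta>"
  proof -
    have "(T ^^ p') y' = (T ^^ (r (Suc N) * p)) y"
      unfolding Ty' by (simp only: p'_def nm add_mult_distrib)
    then show ?thesis
      using N[of "Suc N" N] by (simp add: y'_def n_def)
  qed
  have y'X: "(T ^^ j) y' \<in> X" for j
    unfolding Ty' using funpow_in[OF TX y(1)] .
  have p': "p' \<ge> 1" using m p(1) by (simp add: p'_def)
  have step: "(f i, f (Suc i)) \<in> chain_step X T \<delta>" if "i < p'" for i
  proof (cases "Suc i = p'")
    case True
    then show ?thesis
      using ret y'X[of i] y'X[of 0] that by (auto simp: f_def chain_step_def)
  next
    case False
    then show ?thesis
      using y'X[of i] y'X[of "Suc i"] that \<open>\<delta> > 0\<close> by (auto simp: f_def chain_step_def)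
  qed
  have "pseudo_orbit X T \<delta> (\<lambda>j. f (j mod p'))"
    using pseudo_orbit_mod[of p' f X T \<delta> 0] p' step by (simp add: f_def)
  moreover have "dist (f (j mod p')) (\<xi> j) < e" for j
  proof -
    have lt: "j mod p' < p'" using p' by simp
    \<comment> \<open>Time \<open>j\<close> of the new sequence is time
      \<open>j mod p' + n * p\<close> of the orbit of \<open>y\<close>, which is congruent to
      \<open>j\<close> modulo \<open>p\<close>.\<close>
    have "\<xi> (j mod p' + n * p) = \<xi> j"
      using p(2)[of "j mod p' + n * p"] p(2)[of j]
      by (simp add: p'_def mod_mod_cancel)
    then show ?thesis
      using y(2) lt unfolding traced_by_def f_def Ty' by (metis less_irrefl)
  qed
  ultimately show ?thesis
    using that[of p' "\<lambda>j. f (j mod p')"] p' by (simp add: p'_def)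
qed

text \<open>Shadowing and \<open>refine_periodic_pseudo_orbit\<close> alternate, with summable
  changes \<open>e n\<close>. The limit is within \<epsilon>/2 of the start, is approximated
  uniformly by periodic sequences, and is a true orbit because the pseudo-orbit errors tend to
  0.\<close>

lemma limit_periodic_shadowing:
  assumes X: "dynamical_system X T" and sh: "shadowing_property X T" and "\<epsilon> > 0"
  obtains \<delta> where "\<delta> > 0"
    "\<And>\<xi> p. p \<ge> 1 \<Longrightarrow> (\<And>j. \<xi> (j mod p) = \<xi> j) \<Longrightarrow> pseudo_orbit X T \<delta> \<xi> \<Longrightarrow>
      \<exists>z\<in>X. limit_periodic T z \<and> traced_by T \<epsilon> \<xi> z"
proof -
  have cX: "compact X" and contX: "continuous_on X T" and TX: "T ` X \<subseteq> X"
    using X by (auto simp: dynamical_system_def)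
  \<comment> \<open>The terms \<open>e n\<close> with \<open>n \<ge> k\<close> add up to
    \<open>\<epsilon> / 2 ^ (k + 1)\<close>, which for \<open>k = 0\<close> is \<epsilon>/2.\<close>
  define e where "e n = \<epsilon> / 2 ^ (n + 2)" for n :: nat
  have e: "e n > 0" for n using \<open>\<epsilon> > 0\<close> by (simp add: e_def)
  \<comment> \<open>The bound \<open>d \<le> e n\<close> makes the pseudo-orbit errors vanish in the
    limit.\<close>
  have "\<exists>d>0. d \<le> e n \<and> (\<forall>x. pseudo_orbit X T d x \<longrightarrow> (\<exists>y\<in>X. traced_by T (e n) x y))" for n
  proof -
    obtain d where d: "d > 0" "\<forall>x. pseudo_orbit X T d x \<longrightarrow> (\<exists>y\<in>X. traced_by T (e n) x y)"
      using sh e[of n] unfolding shadowing_property_def by blast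
    then show ?thesis
      using e[of n] by (intro exI[of _ "min d (e n)"]) (auto simp: pseudo_orbit_def)
  qed
  then obtain d where d: "\<And>n. d n > 0" "\<And>n. d n \<le> e n"
    and tr: "\<And>n x. pseudo_orbit X T (d n) x \<Longrightarrow> \<exists>y\<in>X. traced_by T (e n) x y"
    by metis
  show ?thesis
  proof (rule that[OF d(1)[of 0]])
    fix \<xi>0 :: "nat \<Rightarrow> 'a" and p0 :: nat
    assume init: "p0 \<ge> 1" "\<And>j. \<xi>0 (j mod p0) = \<xi>0 j" "pseudo_orbit X T (d 0) \<xi>0"
    \<comment> \<open>The state is a pseudo-orbit with its period. The clause for
      \<open>n = 0\<close> pins the start of the construction to the given sequence.\<close>
    define P where "P n s \<longleftrightarrow> snd s \<ge> 1 \<and> (\<forall>j. fst s (j mod snd s) = fst s j) \<and>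
      pseudo_orbit X T (d n) (fst s) \<and> (n = 0 \<longrightarrow> s = (\<xi>0, p0))"
      for n :: nat and s :: "(nat \<Rightarrow> 'a) \<times> nat"
    define Q where "Q n s s' \<longleftrightarrow> (\<forall>j. dist (fst s' j) (fst s j) < e n)"
      for n :: nat and s s' :: "(nat \<Rightarrow> 'a) \<times> nat"
    have "\<exists>s. \<forall>n. P n (s n) \<and> Q n (s n) (s (Suc n))"
    proof (rule dependent_nat_choice)
      show "\<exists>s. P 0 s" using init by (auto simp: P_def)
    next
      fix s n assume s: "P n s"
      then have "\<exists>y\<in>X. traced_by T (e n) (fst s) y"
        by (intro tr) (simp add: P_def)
      then obtain y where y: "y \<in> X" "traced_by T (e n) (fst s) y" by blast
      obtain \<xi>' p' where "p' \<ge> 1" "\<And>j. \<xi>' (j mod p') = \<xi>' j" "pseudo_orbit X T (d (Suc n)) \<xi>'"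
        "\<And>j. dist (\<xi>' j) (fst s j) < e n"
        using refine_periodic_pseudo_orbit[OF X y, of "snd s" "d (Suc n)"] s d(1)
        unfolding P_def by metis
      then show "\<exists>s'. P (Suc n) s' \<and> Q n s s'"
        by (intro exI[of _ "(\<xi>', p')"]) (simp add: P_def Q_def)
    qed
    then obtain s where s: "\<And>n. P n (s n)" "\<And>n. Q n (s n) (s (Suc n))" by blast
    define \<xi> p where "\<xi> n = fst (s n)" and "p n = snd (s n)" for n
    have p: "p n \<ge> 1" and per: "\<xi> n (j mod p n) = \<xi> n j"
      and \<xi>X: "\<xi> n j \<in> X" and po: "dist (T (\<xi> n j)) (\<xi> n (Suc j)) < d n" for n j
      using s(1)[of n] by (auto simp: P_def \<xi>_def p_def pseudo_orbit_def)
    have \<xi>0: "\<xi> 0 = \<xi>0" using s(1)[of 0] by (simp add: P_def \<xi>_def)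
    have close: "dist (\<xi> (Suc n) j) (\<xi> n j) < e n" for n j
      using s(2)[of n] by (simp add: Q_def \<xi>_def)
    \<comment> \<open>The exact value of the partial geometric sum is kept so that the induction
      closes.\<close>
    have tele: "dist (\<xi> (k + m) j) (\<xi> k j) \<le> \<epsilon> / 2 ^ (k + 1) - \<epsilon> / 2 ^ (k + m + 1)" for k m j
    proof (induction m)
      case 0
      show ?case by simp
    next
      case (Suc m)
      have "dist (\<xi> (k + Suc m) j) (\<xi> k j) \<le> e (k + m) + (\<epsilon> / 2 ^ (k + 1) - \<epsilon> / 2 ^ (k + m + 1))"
        using dist_triangle[of "\<xi> (k + Suc m) j" "\<xi> k j" "\<xi> (k + m) j"] Suc close[of "k + m" j]
        by simp
      also have "\<dots> = \<epsilon> / 2 ^ (k + 1) - \<epsilon> / 2 ^ (k + Suc m + 1)"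
        by (simp add: e_def field_simps)
      finally show ?case .
    qed
    have tele': "dist (\<xi> n j) (\<xi> k j) \<le> \<epsilon> / 2 ^ (k + 1)" if "k \<le> n" for k n j
      using tele[of k "n - k" j] that \<open>\<epsilon> > 0\<close>
      by (smt (verit) le_add_diff_inverse zero_less_divide_iff zero_less_power)
    have small: "\<exists>k. \<epsilon> / 2 ^ k < \<eta>" if "\<eta> > 0" for \<eta>
    proof -
      have "(\<lambda>k. \<epsilon> / 2 ^ k) \<longlonglongrightarrow> 0"
        by (simp add: LIMSEQ_divide_realpow_zero)
      then show ?thesis
        using that order_tendstoD(2)[of _ 0 sequentially \<eta>] eventually_happens by fastforce
    qed
    have "\<exists>l\<in>X. (\<lambda>n. \<xi> n j) \<longlonglongrightarrow> l" for j
    proof -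
      have "Cauchy (\<lambda>n. \<xi> n j)"
        unfolding Cauchy_altdef2
      proof (intro allI impI)
        fix \<eta> :: real assume "\<eta> > 0"
        then obtain k where k: "\<epsilon> / 2 ^ k < \<eta>" using small by blast
        have "\<epsilon> / 2 ^ (k + 1) \<le> \<epsilon> / 2 ^ k" using \<open>\<epsilon> > 0\<close> by (simp add: field_simps)
        then show "\<exists>N. \<forall>n\<ge>N. dist (\<xi> n j) (\<xi> N j) < \<eta>"
          using tele'[of k _ j] k by (intro exI[of _ k]) (meson le_less_trans order_trans)
      qed
      moreover have "\<forall>n. \<xi> n j \<in> X" using \<xi>X by simp
      ultimately show ?thesis
        using completeE[OF compact_imp_complete[OF cX], of "\<lambda>n. \<xi> n j"] by metis
    qed
    then obtain w where wX: "\<And>j. w j \<in> X" and w: "\<And>j. (\<lambda>n. \<xi> n j) \<longlonglongrightarrow> w j" by metis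
    have wk: "dist (w j) (\<xi> k j) \<le> \<epsilon> / 2 ^ (k + 1)" for j k
    proof (rule LIMSEQ_le_const2)
      show "(\<lambda>n. dist (\<xi> n j) (\<xi> k j)) \<longlonglongrightarrow> dist (w j) (\<xi> k j)"
        by (intro tendsto_dist w tendsto_const)
      show "\<exists>N. \<forall>n\<ge>N. dist (\<xi> n j) (\<xi> k j) \<le> \<epsilon> / 2 ^ (k + 1)"
        using tele' by blast
    qed
    have Tw: "T (w j) = w (Suc j)" for j
    proof -
      have "(\<lambda>n. T (\<xi> n j)) \<longlonglongrightarrow> T (w j)"
        using contX wX \<xi>X w by (intro continuous_on_tendsto_compose[OF contX w]) auto
      then have "(\<lambda>n. dist (T (\<xi> n j)) (\<xi> n (Suc j))) \<longlonglongrightarrow> dist (T (w j)) (w (Suc j))"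
        using w by (intro tendsto_dist)
      moreover have "(\<lambda>n. dist (T (\<xi> n j)) (\<xi> n (Suc j))) \<longlonglongrightarrow> 0"
      proof (rule tendsto_sandwich[of "\<lambda>_. 0" _ _ e])
        have "(\<lambda>n. \<epsilon> / 2 ^ n / 4) \<longlonglongrightarrow> 0 / 4"
          by (intro tendsto_divide LIMSEQ_divide_realpow_zero tendsto_const) auto
        then show "e \<longlonglongrightarrow> 0" by (simp add: e_def[abs_def] field_simps)
        show "\<forall>\<^sub>F n in sequentially. dist (T (\<xi> n j)) (\<xi> n (Suc j)) \<le> e n"
          using po d(2) by (intro always_eventually allI) (meson less_imp_le order_trans)
      qed auto
      ultimately show ?thesis
        using LIMSEQ_unique by fastforce
    qed
    have orb: "(T ^^ j) (w 0) = w j" for j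
      by (induction j) (auto simp: Tw)
    have "limit_periodic T (w 0)"
      unfolding limit_periodic_def orb
    proof (intro allI impI)
      fix \<eta> :: real assume "\<eta> > 0"
      then obtain k where k: "\<epsilon> / 2 ^ k < \<eta>" using small by blast
      have "dist (w j) (w (n * p k + j)) < \<eta>" for n j
      proof -
        \<comment> \<open>Both points of the limit are compared with the same value of the periodic
          sequence \<open>\<xi> k\<close>.\<close>
        have "\<xi> k (n * p k + j) = \<xi> k j"
          using per[of k j] per[of k "n * p k + j"] by simp
        then have "dist (w j) (w (n * p k + j)) \<le> \<epsilon> / 2 ^ (k + 1) + \<epsilon> / 2 ^ (k + 1)"
          using dist_triangle2[of "w j" "w (n * p k + j)" "\<xi> k j"] wk[of j k] wk[of "n * p k + j" k]
          by simp
        also have "\<dots> = \<epsilon> / 2 ^ k" by simp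
        finally show ?thesis using k by simp
      qed
      then show "\<exists>q\<ge>1. \<forall>n j. dist (w j) (w (n * q + j)) < \<eta>"
        using p by blast
    qed
    moreover have "traced_by T \<epsilon> \<xi>0 (w 0)"
      unfolding traced_by_def orb
    proof
      fix j
      have "dist (w j) (\<xi>0 j) \<le> \<epsilon> / 2" using wk[of j 0] by (simp add: \<xi>0)
      then show "dist (w j) (\<xi>0 j) < \<epsilon>" using \<open>\<epsilon> > 0\<close> by simp
    qed
    ultimately show "\<exists>z\<in>X. limit_periodic T z \<and> traced_by T \<epsilon> \<xi>0 z"
      using wX by blast
  qed
qed

section \<open>From weak mixing to chains of every large length\<close>

text \<open>The two ends of an orbit segment of \<open>u\<close> are replaced by \<open>x\<close>
  and \<open>y\<close>. Each replacement costs \<delta>/2, and for \<open>n = 1\<close> both fall on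
  the same step. Closeness is asked of \<open>T x\<close> and \<open>T u\<close>, which is all the
  first step sees.\<close>

lemma chain_of_orbit:
  assumes TX: "T ` X \<subseteq> X" and x: "x \<in> X" and y: "y \<in> X" and u: "u \<in> X"
    and "n > 0" "dist (T x) (T u) < \<delta> / 2" "dist ((T ^^ n) u) y < \<delta> / 2" "\<delta> > 0"
  shows "(x, y) \<in> chain_step X T \<delta> ^^ n"
proof -
  define f where "f i = (if i = 0 then x else if i = n then y else (T ^^ i) u)" for i
  have uX: "(T ^^ j) u \<in> X" for j
    using funpow_in[OF TX u] .
  have "(f i, f (Suc i)) \<in> chain_step X T \<delta>" if "i < n" for i
  proof -
    have "dist (T (f i)) ((T ^^ Suc i) u) < \<delta> / 2"
      using assms that by (auto simp: f_def)
    moreover have "dist ((T ^^ Suc i) u) (f (Suc i)) < \<delta> / 2"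
      using assms by (auto simp: f_def)
    ultimately have "dist (T (f i)) (f (Suc i)) < \<delta>"
      using dist_triangle[of "T (f i)" "f (Suc i)" "(T ^^ Suc i) u"] by linarith
    then show ?thesis
      using x y uX[of i] uX[of "Suc i"] by (auto simp: f_def chain_step_def)
  qed
  moreover have "f 0 = x" "f n = y" using \<open>n > 0\<close> by (auto simp: f_def)
  ultimately show ?thesis unfolding relpow_fun_conv by blast
qed

lemma map_prod_funpow:
  fixes f :: "'a \<Rightarrow> 'a" and g :: "'b \<Rightarrow> 'b"
  shows "map_prod f g ^^ n = map_prod (f ^^ n) (g ^^ n)"
proof (induction n)
  case 0
  show ?case by (simp add: map_prod.id id_def[symmetric])
next
  case (Suc n)
  show ?case by (simp only: funpow.simps Suc map_prod.comp)
qed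

text \<open>Transitivity of the product gives one time \<open>n\<close> that serves both pairs; this
  common length is what weak mixing contributes.\<close>

lemma weakly_mixing_chain_pair:
  assumes X: "dynamical_system X T" and wm: "weakly_mixing X T" and "\<delta> > 0"
    and "x \<in> X" "y \<in> X" "x' \<in> X" "y' \<in> X"
  obtains n where "n > 0" "(x, y) \<in> chain_step X T \<delta> ^^ n" "(x', y') \<in> chain_step X T \<delta> ^^ n"
proof -
  have contX: "continuous_on X T" and TX: "T ` X \<subseteq> X"
    using X by (auto simp: dynamical_system_def)
  have "\<delta> / 2 > 0" using \<open>\<delta> > 0\<close> by simp
  define N where "N v = {u \<in> X. dist (T v) (T u) < \<delta> / 2}" for v
  define B where "B v = {u \<in> X. dist v u < \<delta> / 2}" for v
  have "openin (top_of_set X) (X \<inter> T -` ball (T v) (\<delta> / 2))" for v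
    using contX by (rule continuous_openin_preimage_gen) simp
  then have N: "openin (top_of_set X) (N v)" for v
    by (simp add: N_def ball_def Collect_conj_eq vimage_def)
  have "openin (top_of_set X) (X \<inter> ball v (\<delta> / 2))" for v
    by (rule openin_open_Int) simp
  then have B: "openin (top_of_set X) (B v)" for v
    by (simp add: B_def ball_def Collect_conj_eq)
  have "openin (top_of_set (X \<times> X)) (N x \<times> N x')" "openin (top_of_set (X \<times> X)) (B y \<times> B y')"
    using N B by (auto intro: openin_Times)
  moreover have "(x, x') \<in> N x \<times> N x'" "(y, y') \<in> B y \<times> B y'"
    using assms by (auto simp: N_def B_def)
  ultimately obtain n where n: "n > 0" "(map_prod T T ^^ n) ` (N x \<times> N x') \<inter> (B y \<times> B y') \<noteq> {}"
    using wm unfolding weakly_mixing_def transitive_system_def by (metis empty_iff)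
  then obtain u u' where "u \<in> N x" "u' \<in> N x'" "(T ^^ n) u \<in> B y" "(T ^^ n) u' \<in> B y'"
    unfolding map_prod_funpow by auto
  then show ?thesis
    using assms n(1) chain_of_orbit[OF TX, of x y u n \<delta>] chain_of_orbit[OF TX, of x' y' u' n \<delta>]
    by (intro that[of n]) (simp_all add: N_def B_def dist_commute)
qed

lemma relpow_mult_loop:
  assumes "(x, x) \<in> R ^^ n"
  shows "(x, x) \<in> R ^^ (m * n)"
proof (induction m)
  case 0
  show ?case by simp
next
  case (Suc m)
  show ?case
    unfolding mult_Suc relpow_add using assms Suc by (rule relcompI)
qed

text \<open>Writing \<open>m = q * n + r\<close> with \<open>r < n \<le> q\<close> gives
  \<open>m = (q - r) * n + r * (n + 1)\<close>: go round the short loop \<open>q - r\<close> times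
  and the long one \<open>r\<close> times.\<close>

lemma relpow_consecutive_loops:
  assumes "(x, x) \<in> R ^^ n" "(x, x) \<in> R ^^ Suc n" "n > 0" "m \<ge> n * n"
  shows "(x, x) \<in> R ^^ m"
proof -
  define q r where "q = m div n" and "r = m mod n"
  have "r < n" using \<open>n > 0\<close> by (simp add: r_def)
  also have "n \<le> q"
    using assms(3,4) by (simp add: q_def less_eq_div_iff_mult_less_eq)
  finally obtain s where q: "q = s + r"
    by (metis add.commute le_Suc_ex less_imp_le)
  have "m = q * n + r" by (simp add: q_def r_def)
  then have m: "m = s * n + r * Suc n" by (simp add: q algebra_simps)
  show ?thesis
    unfolding m relpow_add using relpow_mult_loop[OF assms(1)] relpow_mult_loop[OF assms(2)] by blast
qed

text \<open>The maximum of the local thresholds over a finite subcover works everywhere, by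
  monotonicity. This makes bounds on chain lengths uniform in the endpoints.\<close>

lemma compact_uniform_threshold:
  fixes P :: "nat \<Rightarrow> 'a::topological_space \<Rightarrow> bool"
  assumes "compact X" and mono: "\<And>s t x. s \<le> t \<Longrightarrow> P s x \<Longrightarrow> P t x"
    and loc: "\<And>x. x \<in> X \<Longrightarrow> \<exists>s U. openin (top_of_set X) U \<and> x \<in> U \<and> (\<forall>u\<in>U. P s u)"
  obtains N where "\<And>x. x \<in> X \<Longrightarrow> P N x"
proof -
  have "\<exists>s V. open V \<and> x \<in> V \<and> (\<forall>u\<in>V \<inter> X. P s u)" if x: "x \<in> X" for x
  proof -
    obtain s U where "openin (top_of_set X) U" "x \<in> U" "\<forall>u\<in>U. P s u"
      using loc[OF x] by blast
    then show ?thesis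
      unfolding openin_open by blast
  qed
  then obtain s V where V: "\<And>x. x \<in> X \<Longrightarrow> open (V x)" "\<And>x. x \<in> X \<Longrightarrow> x \<in> V x"
    "\<And>x u. x \<in> X \<Longrightarrow> u \<in> V x \<inter> X \<Longrightarrow> P (s x) u" by metis
  then have "X \<subseteq> (\<Union>x\<in>X. V x)" by blast
  then obtain F where F: "F \<subseteq> X" "finite F" "X \<subseteq> (\<Union>x\<in>F. V x)"
    by (rule compactE_image[OF \<open>compact X\<close>, of X V, rotated]) (simp_all add: V(1))
  show ?thesis
  proof (rule that[of "Max (s ` F)"])
    fix u assume "u \<in> X"
    then obtain x where x: "x \<in> F" "u \<in> V x" using F(3) by blast
    show "P (Max (s ` F)) u"
    proof (rule mono)
      show "s x \<le> Max (s ` F)" using x(1) F(2) by simp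
      show "P (s x) u" using V(3)[of x u] x F(1) \<open>u \<in> X\<close> by auto
    qed
  qed
qed

text \<open>All chains are routed through a base point \<open>c\<close>, where loops of every large
  length absorb the excess. Chains into and out of \<open>c\<close> survive small changes of the
  other endpoint, so compactness yields uniform bounds \<open>N1\<close> and
  \<open>N2\<close>.\<close>

lemma weakly_mixing_imp_chain_mixing:
  assumes X: "dynamical_system X T" and wm: "weakly_mixing X T" and "\<delta> > 0"
  obtains M where "\<And>n x y. n \<ge> M \<Longrightarrow> x \<in> X \<Longrightarrow> y \<in> X \<Longrightarrow> (x, y) \<in> chain_step X T \<delta> ^^ n"
proof (cases "X = {}")
  case True
  then show ?thesis using that by blast
next
  case False
  then obtain c where c: "c \<in> X" by blast
  let ?R = "chain_step X T \<delta>"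
  have cX: "compact X" and contX: "continuous_on X T" and TX: "T ` X \<subseteq> X"
    using X by (auto simp: dynamical_system_def)
  have Tc: "T c \<in> X" using TX c by blast
  \<comment> \<open>Chains of the same length \<open>l\<close> from \<open>c\<close> and from
    \<open>T c\<close> to \<open>c\<close>: putting the exact step from \<open>c\<close> to
    \<open>T c\<close> before the second gives a loop of length \<open>l + 1\<close>.\<close>
  obtain l where l: "l > 0" "(c, c) \<in> ?R ^^ l" "(T c, c) \<in> ?R ^^ l"
    using weakly_mixing_chain_pair[OF assms c c Tc c] by blast
  have "(c, T c) \<in> ?R" using c Tc \<open>\<delta> > 0\<close> by (simp add: chain_step_def)
  then have "(c, c) \<in> ?R ^^ Suc l" using l(3) by (rule relpow_Suc_I2)
  then have loop: "(c, c) \<in> ?R ^^ m" if "m \<ge> l * l" for m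
    using relpow_consecutive_loops[OF l(2)] l(1) that by blast
  obtain N1 where N1: "\<And>x. x \<in> X \<Longrightarrow> \<forall>n\<ge>N1. (x, c) \<in> ?R ^^ n"
  proof (rule compact_uniform_threshold[OF cX, of "\<lambda>s x. \<forall>n\<ge>s. (x, c) \<in> ?R ^^ n"])
    fix x assume x: "x \<in> X"
    obtain n where "n > 0" "(x, c) \<in> ?R ^^ n"
      using weakly_mixing_chain_pair[OF assms x c x c] by blast
    then obtain k w where w: "(x, w) \<in> ?R" "(w, c) \<in> ?R ^^ k"
      by (metis gr0_conv_Suc relpow_Suc_D2)
    \<comment> \<open>Only the first step of the chain depends on its start, so any \<open>u\<close>
      whose image is \<delta>-close to \<open>w\<close> may replace \<open>x\<close>.\<close>
    define U where "U = X \<inter> T -` ball w \<delta>"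
    have "openin (top_of_set X) U"
      unfolding U_def using contX by (rule continuous_openin_preimage_gen) simp
    moreover have "x \<in> U" using w(1) by (simp add: U_def chain_step_def dist_commute)
    moreover have "(u, c) \<in> ?R ^^ m" if "u \<in> U" "m \<ge> Suc k + l * l" for u m
    proof -
      have "(u, w) \<in> ?R" using that(1) w(1) by (simp add: U_def chain_step_def dist_commute)
      then have "(u, c) \<in> ?R ^^ Suc k" using w(2) by (rule relpow_Suc_I2)
      moreover have "(c, c) \<in> ?R ^^ (m - Suc k)" using that(2) by (intro loop) simp
      ultimately have "(u, c) \<in> ?R ^^ (Suc k + (m - Suc k))"
        unfolding relpow_add by blast
      then show ?thesis using that(2) by simp
    qed
    ultimately show "\<exists>s U. openin (top_of_set X) U \<and> x \<in> U \<and> (\<forall>u\<in>U. \<forall>n\<ge>s. (u, c) \<in> ?R ^^ n)"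
      by blast
  qed auto
  obtain N2 where N2: "\<And>x. x \<in> X \<Longrightarrow> \<forall>n\<ge>N2. (c, x) \<in> ?R ^^ n"
  proof (rule compact_uniform_threshold[OF cX, of "\<lambda>s x. \<forall>n\<ge>s. (c, x) \<in> ?R ^^ n"])
    fix x assume x: "x \<in> X"
    obtain n where "n > 0" "(c, x) \<in> ?R ^^ n"
      using weakly_mixing_chain_pair[OF assms c x c x] by blast
    then obtain k w where w: "(c, w) \<in> ?R ^^ k" "(w, x) \<in> ?R"
      by (metis gr0_conv_Suc relpow_Suc_E)
    \<comment> \<open>Likewise, only the last step depends on the end of the chain.\<close>
    define U where "U = X \<inter> ball (T w) \<delta>"
    have "openin (top_of_set X) U"
      unfolding U_def by (rule openin_open_Int) simp
    moreover have "x \<in> U" using w(2) by (simp add: U_def chain_step_def)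
    moreover have "(c, u) \<in> ?R ^^ m" if "u \<in> U" "m \<ge> Suc k + l * l" for u m
    proof -
      have "(w, u) \<in> ?R" using that(1) w(2) by (simp add: U_def chain_step_def)
      with w(1) have "(c, u) \<in> ?R ^^ Suc k" by (rule relpow_Suc_I)
      moreover have "(c, c) \<in> ?R ^^ (m - Suc k)" using that(2) by (intro loop) simp
      ultimately have "(c, u) \<in> ?R ^^ ((m - Suc k) + Suc k)"
        unfolding relpow_add by blast
      then show ?thesis using that(2) by simp
    qed
    ultimately show "\<exists>s U. openin (top_of_set X) U \<and> x \<in> U \<and> (\<forall>u\<in>U. \<forall>n\<ge>s. (c, u) \<in> ?R ^^ n)"
      by blast
  qed auto
  show ?thesis
  proof (rule that[of "N1 + N2"])
    fix n x y assume n: "n \<ge> N1 + N2" and xy: "x \<in> X" "y \<in> X"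
    have "(x, c) \<in> ?R ^^ N1" "(c, y) \<in> ?R ^^ (n - N1)"
      using N1[OF xy(1)] N2[OF xy(2)] n by auto
    then have "(x, y) \<in> ?R ^^ (N1 + (n - N1))"
      unfolding relpow_add by blast
    then show "(x, y) \<in> ?R ^^ n" using n by simp
  qed
qed

section \<open>Periodic pseudo-orbits through prescribed orbit segments\<close>

text \<open>Induction over the segments, bridging each gap by a chain, which exists because gaps are
  at least \<open>M\<close>. The chain is indexed by absolute time, and \<open>b i \<le> b l\<close>
  is carried along so that an extension after \<open>b l\<close> leaves earlier segments
  untouched.\<close>

lemma chain_through_segments:
  fixes k l :: nat
  assumes X: "dynamical_system X T" and "\<delta> > 0"
    and M: "\<And>n x y. n \<ge> M \<Longrightarrow> x \<in> X \<Longrightarrow> y \<in> X \<Longrightarrow> (x, y) \<in> chain_step X T \<delta> ^^ n"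
    and x: "\<forall>i\<in>{1..k}. x i \<in> X" and ab: "\<forall>i\<in>{1..k}. a i \<le> b i"
    and ba: "\<forall>i\<in>{2..k}. b (i - 1) < a i" and gap: "\<forall>i\<in>{2..k}. a i \<ge> M + b (i - 1)"
    and "1 \<le> l" "l \<le> k"
  shows "a 1 \<le> b l \<and> (\<exists>f. (\<forall>j. a 1 \<le> j \<and> j < b l \<longrightarrow> (f j, f (Suc j)) \<in> chain_step X T \<delta>) \<and>
    (\<forall>i\<in>{1..l}. b i \<le> b l \<and> (\<forall>j\<in>{a i..b i}. f j = (T ^^ j) (x i))))"
  using \<open>1 \<le> l\<close> \<open>l \<le> k\<close>
proof (induction l rule: dec_induct)
  have TX: "T ` X \<subseteq> X" using X by (simp add: dynamical_system_def)
  have seg: "((T ^^ j) (x i), (T ^^ Suc j) (x i)) \<in> chain_step X T \<delta>" if "i \<in> {1..k}" for i j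
    using funpow_in[OF TX, of "x i" j] funpow_in[OF TX, of "x i" "Suc j"] x that \<open>\<delta> > 0\<close>
    by (simp add: chain_step_def)
  {
    case base
    then show ?case
      using ab seg by (intro conjI exI[of _ "\<lambda>j. (T ^^ j) (x 1)"]) auto
  next
    case (step l)
    let ?l = "Suc l"
    obtain f where a1: "a 1 \<le> b l"
      and f: "\<And>j. a 1 \<le> j \<Longrightarrow> j < b l \<Longrightarrow> (f j, f (Suc j)) \<in> chain_step X T \<delta>"
      and bl: "\<And>i. i \<in> {1..l} \<Longrightarrow> b i \<le> b l"
      and fx: "\<And>i j. i \<in> {1..l} \<Longrightarrow> j \<in> {a i..b i} \<Longrightarrow> f j = (T ^^ j) (x i)"
      using step by fastforce
    have lk: "?l \<in> {2..k}" "?l \<in> {1..k}" "l \<in> {1..k}" "l \<in> {1..l}"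
      using step.hyps step.prems by auto
    have lt: "b l < a ?l" and gp: "a ?l - b l \<ge> M" and le: "a ?l \<le> b ?l" "a l \<le> b l"
      using ab ba gap lk by fastforce+
    have "((T ^^ b l) (x l), (T ^^ a ?l) (x ?l)) \<in> chain_step X T \<delta> ^^ (a ?l - b l)"
      using x lk by (intro M gp funpow_in[OF TX]) auto
    then obtain g where g: "g 0 = (T ^^ b l) (x l)" "g (a ?l - b l) = (T ^^ a ?l) (x ?l)"
      "\<And>i. i < a ?l - b l \<Longrightarrow> (g i, g (Suc i)) \<in> chain_step X T \<delta>"
      unfolding relpow_fun_conv by blast
    have fb: "f (b l) = g 0" using fx[of l "b l"] lk le g(1) by simp
    \<comment> \<open>The old chain, then the bridge, then the true orbit of the next point.
      Adjacent pieces agree at \<open>b l\<close> and at \<open>a ?l\<close>.\<close>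
    define h where "h j = (if j \<le> b l then f j else if j \<le> a ?l then g (j - b l)
      else (T ^^ j) (x ?l))" for j
    have "(h j, h (Suc j)) \<in> chain_step X T \<delta>" if j: "a 1 \<le> j" for j
    proof -
      consider "j < b l" | "b l \<le> j" "j < a ?l" | "a ?l \<le> j" by linarith
      then show ?thesis
      proof cases
        case 1
        then show ?thesis using f[OF j] by (simp add: h_def)
      next
        case 2
        then have "h j = g (j - b l)" "h (Suc j) = g (Suc (j - b l))"
          using fb by (auto simp: h_def Suc_diff_le)
        then show ?thesis using g(3)[of "j - b l"] 2 by simp
      next
        case 3
        then have "h j = (T ^^ j) (x ?l)" "h (Suc j) = (T ^^ Suc j) (x ?l)"
          using g(2) lt by (auto simp: h_def)
        then show ?thesis using seg[OF lk(2)] by simp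
      qed
    qed
    moreover have "b i \<le> b ?l \<and> (\<forall>j\<in>{a i..b i}. h j = (T ^^ j) (x i))" if i: "i \<in> {1..?l}" for i
    proof (cases "i = ?l")
      case True
      then show ?thesis using lt g(2) by (auto simp: h_def)
    next
      case False
      then have i: "i \<in> {1..l}" using i by auto
      then show ?thesis
        using bl[OF i] fx[OF i] lt le by (auto simp: h_def)
    qed
    moreover have "a 1 \<le> b ?l" using a1 lt le by simp
    ultimately show ?case by blast
  }
qed

theorem proposition3p10:
  fixes X :: "'a::metric_space set" and T :: "'a \<Rightarrow> 'a"
  assumes "dynamical_system X T"
    and "weakly_mixing X T"
    and "shadowing_property X T"
  shows "\<forall>\<epsilon>::real. \<epsilon> > 0 \<longrightarrow> (\<exists>M::nat. M > 0 \<and>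
    (\<forall>(k::nat) (x::nat \<Rightarrow> 'a) (a::nat \<Rightarrow> nat) (b::nat \<Rightarrow> nat) (p::nat).
      k \<ge> 2 \<longrightarrow>
      (\<forall>i\<in>{1..k}. x i \<in> X) \<longrightarrow>
      (\<forall>i\<in>{1..k}. a i \<le> b i) \<longrightarrow>
      (\<forall>i\<in>{2..k}. b (i - 1) < a i) \<longrightarrow>
      (\<forall>i\<in>{2..k}. int (a i) - int (b (i - 1)) \<ge> int M) \<longrightarrow>
      int p \<ge> int M + int (b k) - int (a 1) \<longrightarrow>
      (\<exists>z\<in>X. odometer (orbit_closure T z) T \<and>
        (\<forall>n j. dist ((T ^^ j) z) ((T ^^ (n * p + j)) z) < \<epsilon>) \<and>
        (\<forall>i\<in>{1..k}. \<forall>j\<in>{a i..b i}. \<forall>n.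
          dist ((T ^^ (n * p + j)) z) ((T ^^ j) (x i)) < \<epsilon>))))"
proof (intro allI impI)
  fix \<epsilon> :: real assume "\<epsilon> > 0"
  \<comment> \<open>Half of \<epsilon>, since comparing times \<open>j\<close> and
    \<open>n * p + j\<close> uses the tracing twice.\<close>
  then have "\<epsilon> / 2 > 0" by simp
  then obtain \<delta> where "\<delta> > 0" and shadow:
    "\<And>\<xi> p. p \<ge> 1 \<Longrightarrow> (\<And>j. \<xi> (j mod p) = \<xi> j) \<Longrightarrow> pseudo_orbit X T \<delta> \<xi> \<Longrightarrow>
      \<exists>z\<in>X. limit_periodic T z \<and> traced_by T (\<epsilon> / 2) \<xi> z"
    using limit_periodic_shadowing[OF assms(1,3)] by metis
  obtain M0 where M0: "\<And>n x y. n \<ge> M0 \<Longrightarrow> x \<in> X \<Longrightarrow> y \<in> X \<Longrightarrow> (x, y) \<in> chain_step X T \<delta> ^^ n"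
    using weakly_mixing_imp_chain_mixing[OF assms(1,2) \<open>\<delta> > 0\<close>] by blast
  \<comment> \<open>The successor makes \<open>M\<close> positive, hence \<open>p\<close> positive
    and strictly larger than \<open>L\<close>.\<close>
  define M where "M = Suc M0"
  have M: "\<And>n x y. n \<ge> M \<Longrightarrow> x \<in> X \<Longrightarrow> y \<in> X \<Longrightarrow> (x, y) \<in> chain_step X T \<delta> ^^ n"
    using M0 by (simp add: M_def)
  have TX: "T ` X \<subseteq> X" using assms(1) by (simp add: dynamical_system_def)
  show "\<exists>M::nat. M > 0 \<and>
    (\<forall>(k::nat) (x::nat \<Rightarrow> 'a) (a::nat \<Rightarrow> nat) (b::nat \<Rightarrow> nat) (p::nat).
      k \<ge> 2 \<longrightarrow>
      (\<forall>i\<in>{1..k}. x i \<in> X) \<longrightarrow>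
      (\<forall>i\<in>{1..k}. a i \<le> b i) \<longrightarrow>
      (\<forall>i\<in>{2..k}. b (i - 1) < a i) \<longrightarrow>
      (\<forall>i\<in>{2..k}. int (a i) - int (b (i - 1)) \<ge> int M) \<longrightarrow>
      int p \<ge> int M + int (b k) - int (a 1) \<longrightarrow>
      (\<exists>z\<in>X. odometer (orbit_closure T z) T \<and>
        (\<forall>n j. dist ((T ^^ j) z) ((T ^^ (n * p + j)) z) < \<epsilon>) \<and>
        (\<forall>i\<in>{1..k}. \<forall>j\<in>{a i..b i}. \<forall>n.
          dist ((T ^^ (n * p + j)) z) ((T ^^ j) (x i)) < \<epsilon>)))"
  proof (intro exI[of _ M] conjI allI impI)
    show "M > 0" by (simp add: M_def)
  next
    fix k :: nat and x :: "nat \<Rightarrow> 'a" and a b :: "nat \<Rightarrow> nat" and p :: nat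
    assume k: "k \<ge> 2" and x: "\<forall>i\<in>{1..k}. x i \<in> X" and ab: "\<forall>i\<in>{1..k}. a i \<le> b i"
      and ba: "\<forall>i\<in>{2..k}. b (i - 1) < a i"
      and gap: "\<forall>i\<in>{2..k}. int (a i) - int (b (i - 1)) \<ge> int M"
      and p: "int p \<ge> int M + int (b k) - int (a 1)"
    have gap': "\<forall>i\<in>{2..k}. a i \<ge> M + b (i - 1)"
    proof
      fix i assume "i \<in> {2..k}"
      then show "a i \<ge> M + b (i - 1)" using bspec[OF gap] by fastforce
    qed
    have k1: "1 \<le> k" "k \<in> {1..k}" "1 \<in> {1..k}" using k by auto
    have seg: "a 1 \<le> b l \<and> (\<exists>f. (\<forall>j. a 1 \<le> j \<and> j < b l \<longrightarrow> (f j, f (Suc j)) \<in> chain_step X T \<delta>) \<and>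
      (\<forall>i\<in>{1..l}. b i \<le> b l \<and> (\<forall>j\<in>{a i..b i}. f j = (T ^^ j) (x i))))" if "1 \<le> l" "l \<le> k" for l
      using chain_through_segments[OF assms(1) \<open>\<delta> > 0\<close> M x ab ba gap' that] .
    have a1: "a 1 \<le> a i" if "i \<in> {1..k}" for i
    proof (cases "i = 1")
      case False
      then have "i \<in> {2..k}" using that by auto
      then have "a 1 \<le> b (i - 1)" "b (i - 1) < a i"
        using seg[of "i - 1"] ba by auto
      then show ?thesis by simp
    qed simp
    obtain f where a1k: "a 1 \<le> b k"
      and f: "\<And>j. a 1 \<le> j \<Longrightarrow> j < b k \<Longrightarrow> (f j, f (Suc j)) \<in> chain_step X T \<delta>"
      and bk: "\<And>i. i \<in> {1..k} \<Longrightarrow> b i \<le> b k"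
      and fx: "\<And>i j. i \<in> {1..k} \<Longrightarrow> j \<in> {a i..b i} \<Longrightarrow> f j = (T ^^ j) (x i)"
      using seg[OF k1(1) order_refl] by fastforce
    define L where "L = b k - a 1"
    have pL: "p \<ge> M + L" using p a1k by (simp add: L_def)
    then have p1: "p \<ge> 1" by (simp add: M_def)
    \<comment> \<open>Since \<open>p - L \<ge> M\<close>, the end of the last segment can be joined
      back to the start of the first so that the loop has exactly \<open>p\<close> steps.\<close>
    have "(f (b k), f (a 1)) \<in> chain_step X T \<delta> ^^ (p - L)"
      using fx[OF k1(2), of "b k"] fx[OF k1(3), of "a 1"] ab k1 x pL
      by (intro M) (auto intro!: funpow_in[OF TX])
    then obtain g where g: "g 0 = f (b k)" "g (p - L) = f (a 1)"
      "\<And>i. i < p - L \<Longrightarrow> (g i, g (Suc i)) \<in> chain_step X T \<delta>"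
      unfolding relpow_fun_conv by blast
    define h where "h i = (if i \<le> L then f (a 1 + i) else g (i - L))" for i
    have hL: "h i = g (i - L)" if "L \<le> i" for i
      using that g(1) a1k by (auto simp: h_def L_def)
    have step: "(h i, h (Suc i)) \<in> chain_step X T \<delta>" if "i < p" for i
    proof (cases "i < L")
      case True
      then show ?thesis using f[of "a 1 + i"] by (simp add: h_def L_def)
    next
      case False
      then show ?thesis using g(3)[of "i - L"] that hL[of i] hL[of "Suc i"] by (simp add: Suc_diff_le)
    qed
    have loop: "h p = h 0" using hL[of p] g(2) pL by (simp add: h_def)
    text \<open>The loop \<open>h\<close> starts at time \<open>a 1\<close>; adding \<open>a 1 * (p - 1)\<close> is shifting by \<open>- a 1\<close>
      modulo \<open>p\<close>.\<close>
    define \<xi> where "\<xi> j = h ((j + a 1 * (p - 1)) mod p)" for j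
    have per: "\<xi> (n * p + j) = \<xi> j" for n j
      by (simp add: \<xi>_def add.assoc)
    have "\<xi> (j mod p) = \<xi> j" for j
      by (simp add: \<xi>_def mod_add_left_eq)
    moreover have "pseudo_orbit X T \<delta> \<xi>"
      unfolding \<xi>_def using p1 step loop by (rule pseudo_orbit_mod)
    ultimately obtain z where z: "z \<in> X" "limit_periodic T z" "traced_by T (\<epsilon> / 2) \<xi> z"
      using shadow[OF p1] by blast
    have tr: "dist ((T ^^ j) z) (\<xi> j) < \<epsilon> / 2" for j
      using z(3) by (simp add: traced_by_def)
    have \<xi>x: "\<xi> j = (T ^^ j) (x i)" if i: "i \<in> {1..k}" and j: "j \<in> {a i..b i}" for i j
    proof -
      have "a 1 \<le> j" "j \<le> b k" using a1[OF i] bk[OF i] j by auto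
      then obtain s where s: "j = a 1 + s" "s \<le> L"
        by (metis L_def diff_le_mono le_add_diff_inverse)
      \<comment> \<open>The shift cancels modulo \<open>p\<close>, leaving the position
        \<open>s\<close> of time \<open>j\<close> in the loop, counted from \<open>a 1\<close>;
        since \<open>s < p\<close>, reducing modulo \<open>p\<close> does not change it.\<close>
      have "j + a 1 * (p - 1) = s + a 1 * p"
        using s(1) p1 by (cases p) auto
      moreover have "s < p" using s(2) pL by (simp add: M_def)
      ultimately have "(j + a 1 * (p - 1)) mod p = s" by simp
      then have "\<xi> j = f j" using s by (simp only: \<xi>_def h_def if_True)
      then show ?thesis using fx[OF i j] by simp
    qed
    show "\<exists>z\<in>X. odometer (orbit_closure T z) T \<and>
        (\<forall>n j. dist ((T ^^ j) z) ((T ^^ (n * p + j)) z) < \<epsilon>) \<and>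
        (\<forall>i\<in>{1..k}. \<forall>j\<in>{a i..b i}. \<forall>n.
          dist ((T ^^ (n * p + j)) z) ((T ^^ j) (x i)) < \<epsilon>)"
    proof (intro bexI[OF _ z(1)] conjI allI ballI)
      show "odometer (orbit_closure T z) T"
        using limit_periodic_imp_odometer[OF assms(1) z(1,2)] .
    next
      fix n j
      show "dist ((T ^^ j) z) ((T ^^ (n * p + j)) z) < \<epsilon>"
        using tr[of j] tr[of "n * p + j"] unfolding per by (rule dist_triangle_half_l)
    next
      fix i j n assume "i \<in> {1..k}" "j \<in> {a i..b i}"
      then show "dist ((T ^^ (n * p + j)) z) ((T ^^ j) (x i)) < \<epsilon>"
        using tr[of "n * p + j"] \<xi>x[of i j] \<open>\<epsilon> > 0\<close> unfolding per by simp
    qed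
  qed
qed

end
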